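(* Let $k\ge 2$, $t\ge 1$, $q\ge 1$ be integers with $\gcd(q,k)=1$, and let $N=k^tq$. Then the period of every periodic stack of $N$ cards (with labels from any finite totally ordered set) under the $k$-stack shuffling is a divisor of $\operatorname{order}_k(N-q)$; and conversely, for every positive divisor $d$ of $\operatorname{order}_k(N-q)$ there exists a periodic stack of $N$ cards (with labels from some finite totally ordered set) with period $d$.
   Context: $\operatorname{order}_k(s)$ denotes the multiplicative order of $k$ modulo $s$, i.e. the least positive integer $M$ with $k^M\equiv 1\pmod s$ (equal to $1$ if $s=1$). A stack of $N=kn$ cards is a sequence $a_0,a_1,\ldots,a_{N-1}$ of labels from a finite totally ordered set $\mathcal{A}_1\succ\mathcal{A}_2\succ\cdots\succ\mathcal{A}_j$ (labels may be repeated). The shuffling sends it to the stack $b_0,\ldots,b_{N-1}$ where, for each $\ell\in\{0,1,\ldots,n-1\}$, the labels $b_{k\ell},b_{k\ell+1},\ldots,b_{k\ell+(k-1)}$ are the labels $a_\ell,a_{\ell+n},\ldots,a_{\ell+(k-1)n}$ (with multiplicity) sorted so that $b_{k\ell}\succeq b_{k\ell+1}\succeq\cdots\succeq b_{k\ell+(k-1)}$. A stack is periodic if it returns to itself after some positive number of shuffles, and its period is the least such number. *)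

theory Defs
  imports "HOL-Number_Theory.Number_Theory"
begin

text \<open>The labels come from a finite subset \<open>A\<close> of a linearly ordered type; \<open>x \<succeq> y\<close> is rendered as
  \<open>x \<ge> y\<close>. A stack \<open>a\<^sub>0, \<dots>, a\<^bsub>N-1\<^esub>\<close> is
  the list of its labels, in this order.\<close>

definition is_stack :: "'a set \<Rightarrow> nat \<Rightarrow> 'a list \<Rightarrow> bool" where
  "is_stack A N a \<longleftrightarrow> length a = N \<and> set a \<subseteq> A"

text \<open>The \<open>l\<close>-th block of the shuffled stack consists of the cards at positions
  \<open>l, l + n, \<dots>, l + (k - 1) n\<close>, in non-increasing order. The definition is meant for stacks
  whose length is the multiple \<open>k * n\<close> of \<open>k\<close>.\<close>

definition block :: "nat \<Rightarrow> nat \<Rightarrow> 'a::linorder list \<Rightarrow> nat \<Rightarrow> 'a list" where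
  "block k n a l = rev (sort (map (\<lambda>i. a ! (l + i * n)) [0..<k]))"

definition stack_shuffle :: "nat \<Rightarrow> 'a::linorder list \<Rightarrow> 'a list" where
  "stack_shuffle k a = (let n = length a div k in concat (map (block k n a) [0..<n]))"

definition periodic_stack :: "nat \<Rightarrow> 'a::linorder list \<Rightarrow> bool" where
  "periodic_stack k a \<longleftrightarrow> (\<exists>m>0. (stack_shuffle k ^^ m) a = a)"

text \<open>Only meaningful for periodic stacks.\<close>

definition stack_period :: "nat \<Rightarrow> 'a::linorder list \<Rightarrow> nat" where
  "stack_period k a = (LEAST m. m > 0 \<and> (stack_shuffle k ^^ m) a = a)"

end

theory Submission
  imports Defs
begin

text \<open>
  Write \<open>N = k n\<close>, \<open>K = k\<^sup>t\<close> and \<open>t = u + 1\<close>. The \<open>k\<close> positions \<open>l + i n\<close> that feed one block agree in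
  the lowest \<open>u\<close> digits to base \<open>k\<close> and, because \<open>q\<close> is prime to \<open>k\<close>, their digits of index \<open>u\<close> are
  \<open>0, \<dots>, k - 1\<close> in some order. Sending the card with top digit \<open>j\<close> to place \<open>j\<close> of the block is a
  permutation \<open>dest\<close> of the positions. It rotates the lowest \<open>t\<close> digits, hence preserves their sum \<open>D\<close>,
  and it multiplies the invariant \<open>Y p = (K - 1) p + (p mod K)\<close> by \<open>k\<close> modulo
  \<open>s = (K - 1) q = N - q\<close> (\<open>Y_dest\<close>). Since \<open>Y\<close> modulo \<open>s\<close>, together with whether \<open>D\<close> vanishes,
  determines the position (\<open>Y_inj\<close>), the order of the permutation divides \<open>ord s k\<close>.

  On a periodic stack the shuffle is this permutation. By threshold maps it suffices to see this for
  labels \<open>True\<close> and \<open>False\<close>. There the sum of \<open>D\<close> over the positions of the true cards never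
  increases under a shuffle, and it is unchanged only if the true cards of each block already have the
  smallest possible top digits (\<open>weight_shuffle\<close>); along a periodic orbit it must be unchanged. So the
  period divides \<open>ord s k\<close>.

  Conversely, put label 1 on all positions of digit sum 0 and on an arbitrary set of positions of digit
  sum 1, and label 0 elsewhere. Every block is then in order for the permutation, so the shuffle just
  permutes the chosen set (\<open>shuffle_low_stack\<close>). Some position of digit sum 1 has \<open>Y = 1\<close>, and its
  orbit is that of 1 under multiplication by \<open>k\<close>. Choosing the positions whose invariant is a power
  of \<open>k\<^sup>d\<close> gives the period \<open>d\<close> (\<open>orbit_stack_period\<close>).
\<close>

section \<open>The shuffle on lists\<close>

lemma length_block [simp]: "length (block k n a l) = k"
  by (simp add: block_def)

lemma length_concat_blocks:
  "(\<And>l. l < n \<Longrightarrow> length (f l) = k) \<Longrightarrow> length (concat (map f [0..<n])) = k * n"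
  by (induction n) auto

lemma nth_concat_blocks:
  assumes "\<And>l. l < n \<Longrightarrow> length (f l) = k" and "l < n" and "j < k"
  shows "concat (map f [0..<n]) ! (k * l + j) = f l ! j"
  using assms
proof (induction n)
  case (Suc n)
  have len: "length (concat (map f [0..<n])) = k * n"
    using Suc.prems by (intro length_concat_blocks) simp
  show ?case
  proof (cases "l = n")
    case True
    then show ?thesis using Suc.prems len by (simp add: nth_append)
  next
    case False
    then have "l < n" using Suc.prems by simp
    then have "k * l + j < k * n"
      using \<open>j < k\<close> by (metis add_less_cancel_left less_le_trans mult_Suc_right mult_le_mono2
          Suc_leI add.commute)
    then show ?thesis using Suc.IH Suc.prems len \<open>l < n\<close> by (simp add: nth_append)
  qed
qed simp

lemma rev_sort_eqI:
  assumes "mset ys = mset xs" and "sorted (rev ys)"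
  shows "rev (sort xs) = ys"
  using properties_for_sort[of "rev ys" xs] assms by simp

lemma map_rev_sort_mono:
  assumes "mono f"
  shows "map f (rev (sort xs)) = rev (sort (map f xs))"
proof -
  have "sorted (map f (sort xs))"
    by (rule sorted_map_mono) (use assms in \<open>auto intro: mono_imp_mono_on monoD mono_onI\<close>)
  then show ?thesis
    by (intro rev_sort_eqI[symmetric]) (auto simp: rev_map)
qed

text \<open>Sorting depends only on the order of the labels, so recolouring by a monotone map can be done
  before or after a shuffle. Applied to the threshold maps \<open>\<lambda>x. c \<le> x\<close>, this reduces questions
  about arbitrary labels to stacks of Booleans.\<close>

lemma map_stack_shuffle_mono:
  assumes "mono f" and "k * n = length a"
  shows "map f (stack_shuffle k a) = stack_shuffle k (map f a)"
proof (cases "k = 0")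
  case False
  then have n: "length a div k = n" using assms(2)
    by (metis nonzero_mult_div_cancel_left)
  have "map f (block k n a l) = block k n (map f a) l" if "l < n" for l
  proof -
    have "l + i * n < length a" if "i < k" for i
    proof -
      have "Suc i * n \<le> k * n" using that by (intro mult_le_mono1) simp
      then show ?thesis using \<open>l < n\<close> assms(2) by simp
    qed
    then have "map f (map (\<lambda>i. a ! (l + i * n)) [0..<k]) = map (\<lambda>i. map f a ! (l + i * n)) [0..<k]"
      by simp
    then show ?thesis
      unfolding block_def map_rev_sort_mono[OF assms(1)] by (simp only:)
  qed
  then have "map (map f \<circ> block k n a) [0..<n] = map (block k n (map f a)) [0..<n]"
    by (intro map_cong) auto
  then show ?thesis
    by (simp only: stack_shuffle_def Let_def length_map n map_concat map_map)
qed (simp add: stack_shuffle_def)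

section \<open>Sorting Booleans minimises the weight of the true entries\<close>

lemma rev_sort_bool:
  "rev (sort xs) = replicate (count (mset xs) True) True @ replicate (count (mset xs) False) False"
proof (rule rev_sort_eqI)
  show "mset (replicate (count (mset xs) True) True @ replicate (count (mset xs) False) False) = mset xs"
  proof (rule multiset_eqI)
    fix b show "count (mset (replicate (count (mset xs) True) True
        @ replicate (count (mset xs) False) False)) b = count (mset xs) b"
      by (cases b) auto
  qed
qed (auto simp: sorted_append)

text \<open>Exchange argument: \<open>S\<close> and \<open>{..<card S}\<close> have equally many elements outside each other, and
  those of \<open>S\<close> are all larger.\<close>

lemma sum_initial_segment_le:
  fixes S :: "nat set"
  assumes "finite S"
  shows "\<Sum>{..<card S} \<le> \<Sum>S" and "\<Sum>{..<card S} = \<Sum>S \<Longrightarrow> S = {..<card S}"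
proof -
  define C where "C = {..<card S}"
  define m where "m = card (S - C)"
  have fin: "finite C" "finite S" using assms by (auto simp: C_def)
  have "card (C - S) = card (S - C)"
    using fin by (simp add: card_Diff_subset_Int Int_commute) (simp add: C_def)
  then have m: "card (C - S) = m" by (simp add: m_def)
  have split: "\<Sum>C = \<Sum>(C \<inter> S) + \<Sum>(C - S)" "\<Sum>S = \<Sum>(C \<inter> S) + \<Sum>(S - C)"
    using fin by (metis sum.Int_Diff, metis sum.Int_Diff Int_commute)
  have up: "m * card S \<le> \<Sum>(S - C)"
    unfolding m_def using sum_bounded_below[of "S - C" "card S" "\<lambda>x. x"] by (auto simp: C_def)
  have low: "\<Sum>(C - S) + m \<le> m * card S"
  proof -
    have "\<Sum>(C - S) + m = (\<Sum>x\<in>C - S. Suc x)" using m fin by (simp add: sum_Suc)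
    also have "\<dots> \<le> m * card S"
      unfolding m[symmetric] using sum_bounded_above[of "C - S" Suc "card S"] by (auto simp: C_def)
    finally show ?thesis .
  qed
  show "\<Sum>{..<card S} \<le> \<Sum>S" using up low split by (simp add: C_def)
  assume "\<Sum>{..<card S} = \<Sum>S"
  then have "m = 0" using up low split by (simp add: C_def)
  then have "C - S = {}" "S - C = {}"
    using m m_def fin by (metis card_0_eq finite_Diff)+
  then show "S = {..<card S}" by (auto simp: C_def)
qed

text \<open>Sorting moves the true entries to the front without changing their number, and an initial
  segment is the unique lightest set of indices of its size.\<close>

lemma bool_sort_weight:
  fixes xs :: "bool list" and e :: nat
  assumes k: "length xs = k"
  shows "(\<Sum>j<k. of_bool (rev (sort xs) ! j) * (e + j)) \<le> (\<Sum>j<k. of_bool (xs ! j) * (e + j))" (is "?L \<le> ?R")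
    and "(\<Sum>j<k. of_bool (rev (sort xs) ! j) * (e + j)) = (\<Sum>j<k. of_bool (xs ! j) * (e + j))
      \<Longrightarrow> rev (sort xs) = xs"
proof -
  define S where "S = {j. j < k \<and> xs ! j}"
  define c where "c = card S"
  have fin: "finite S" by (simp add: S_def)
  have c: "c = count (mset xs) True"
    using k by (simp add: c_def S_def count_mset count_list_eq_length_filter length_filter_conv_card)
  have "c \<le> k"
    using card_mono[of "{..<k}" S] by (auto simp: c_def S_def)
  have nth: "rev (sort xs) ! j = (j < c)" if "j < k" for j
  proof -
    have "count (mset xs) True + count (mset xs) False = k"
    proof -
      have "length (rev (sort xs)) = k" using k by simp
      then show ?thesis by (subst (asm) rev_sort_bool) simp
    qed
    then show ?thesis using that by (subst rev_sort_bool) (auto simp: nth_append c)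
  qed
  have L: "?L = e * c + \<Sum>{..<c}"
  proof -
    have "?L = (\<Sum>j<k. if j < c then e + j else 0)"
      by (intro sum.cong) (auto simp: nth)
    also have "\<dots> = (\<Sum>j<c. e + j)"
      using \<open>c \<le> k\<close> by (intro sum.mono_neutral_cong_right) auto
    finally show ?thesis by (simp add: sum.distrib)
  qed
  have R: "?R = e * c + \<Sum>S"
  proof -
    have "?R = (\<Sum>j\<in>S. e + j)"
      by (intro sum.mono_neutral_cong_right) (auto simp: S_def)
    then show ?thesis by (simp add: sum.distrib c_def)
  qed
  show "?L \<le> ?R" using sum_initial_segment_le(1)[OF fin] L R by (simp add: c_def)
  assume "?L = ?R"
  then have "S = {..<c}" using sum_initial_segment_le(2)[OF fin] L R by (simp add: c_def)
  then have "rev (sort xs) ! j = xs ! j" if "j < k" for j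
    using nth[OF that] that by (auto simp: S_def)
  then show "rev (sort xs) = xs" using k by (intro nth_equalityI) auto
qed

section \<open>Digit sums\<close>

definition digit_sum :: "nat \<Rightarrow> nat \<Rightarrow> nat \<Rightarrow> nat" where
  "digit_sum k u p = (\<Sum>i<u. p div k ^ i mod k)"

lemma digit_sum_top: "digit_sum k (Suc u) p = digit_sum k u p + p div k ^ u mod k"
  by (simp add: digit_sum_def)

lemma digit_sum_append:
  assumes "j < k"
  shows "digit_sum k (Suc u) (k * l + j) = digit_sum k u l + j"
proof -
  have "(k * l + j) div (k * k ^ i) = l div k ^ i" for i
    using assms by (simp add: div_mult2_eq)
  then show ?thesis
    using assms by (simp add: digit_sum_def sum.lessThan_Suc_shift del: sum.lessThan_Suc)
qed

lemma digit_sum_cong: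
  assumes "k > 0" and "[p = p'] (mod k ^ u)"
  shows "digit_sum k u p = digit_sum k u p'"
proof -
  have "x mod k ^ u div k ^ i mod k = x div k ^ i mod k" if "i < u" for x i
  proof -
    have "x mod k ^ u div k ^ i = x div k ^ i mod k ^ (u - i)"
      using that mod_mult2_eq[of x "k ^ i" "k ^ (u - i)"]      using assms(1) by (simp flip: power_add)
    then show ?thesis using that by (simp add: mod_mod_cancel)
  qed
  then show ?thesis
    using assms(2) unfolding digit_sum_def cong_def by (intro sum.cong) (auto, metis)
qed

lemma digit_sum_eq_0_iff:
  assumes "k > 0"
  shows "digit_sum k u p = 0 \<longleftrightarrow> k ^ u dvd p"
proof (induction u arbitrary: p)
  case (Suc u)
  have "digit_sum k (Suc u) p = digit_sum k u (p div k) + p mod k"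
    using digit_sum_append[of "p mod k" k u "p div k"] assms by simp
  then have "digit_sum k (Suc u) p = 0 \<longleftrightarrow> k ^ u dvd p div k \<and> k dvd p"
    using Suc by (auto simp: mod_eq_0_iff_dvd)
  also have "\<dots> \<longleftrightarrow> k ^ Suc u dvd p"
    using assms by (auto simp: dvd_div_iff_mult mult.commute intro: dvd_mult_left)
  finally show ?case .
qed (simp add: digit_sum_def)

section \<open>The underlying permutation\<close>

locale stack_params =
  fixes k u q :: nat
  assumes k: "k \<ge> 2" and q: "q \<ge> 1" and coprime_qk: "coprime q k"
begin

text \<open>The exponent \<open>t\<close> of \<open>k\<close> in \<open>N\<close> is \<open>Suc u\<close>.\<close>

abbreviation K :: nat where "K \<equiv> k ^ Suc u"
abbreviation n :: nat where "n \<equiv> k ^ u * q"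
abbreviation N :: nat where "N \<equiv> k * n"
abbreviation s :: nat where "s \<equiv> (K - 1) * q"
abbreviation D :: "nat \<Rightarrow> nat" where "D \<equiv> digit_sum k (Suc u)"

text \<open>The ideal shuffle: within its block a card is placed according to its digit of index \<open>u\<close>
  instead of its label.\<close>

definition dest :: "nat \<Rightarrow> nat" where
  "dest p = k * (p mod n) + p div k ^ u mod k"

definition src :: "nat \<Rightarrow> nat" where
  "src = inv_into {..<N} dest"

lemma pos: "k > 0" "n > 0" "N > 0" "K > 1" "s > 0"
proof -
  show "k > 0" "n > 0" "N > 0" using k q by auto
  show "K > 1" using k by (intro one_less_power) auto
  then show "s > 0" using q by simp
qed

lemma N_eq: "N = K * q"
  by simp

lemma coprime_K_q: "coprime K q"
  using coprime_qk by (auto simp: coprime_commute)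

lemma index_less: "k * l + j < N" if "l < n" "j < k"
proof -
  have "k * l + j < k * Suc l" using that by simp
  also have "\<dots> \<le> N" using that by (intro mult_le_mono2) simp
  finally show ?thesis .
qed

lemma dest_less: "dest p < N"
  unfolding dest_def using pos by (intro index_less) auto

lemma dest_div: "dest p div k = p mod n" and dest_mod: "dest p mod k = p div k ^ u mod k"
  using pos by (auto simp: dest_def)

lemma cong_N_I:
  assumes "[p = p'] (mod q)" and "[p = p'] (mod K)" and "p < N" and "p' < N"
  shows "p = p'"
proof -
  have "[p = p'] (mod N)"
    unfolding N_eq using assms(1,2) coprime_K_q by (intro coprime_cong_mult_nat)
  then show ?thesis using assms(3,4) by (rule cong_less_modulus_unique_nat)
qed

text \<open>The image determines \<open>p\<close> modulo \<open>n\<close>, hence modulo \<open>q\<close> and its lowest \<open>u\<close> digits, and also the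
  next digit; the Chinese remainder theorem then recovers \<open>p\<close>.\<close>

lemma bij_dest: "bij_betw dest {..<N} {..<N}"
proof -
  have "inj_on dest {..<N}"
  proof (rule inj_onI)
    fix p p' assume p: "p \<in> {..<N}" "p' \<in> {..<N}" "dest p = dest p'"
    have n: "[p = p'] (mod n)" using p(3) dest_div[of p] dest_div[of p'] by (simp add: cong_def)
    have top: "p div k ^ u mod k = p' div k ^ u mod k"
      using p(3) dest_mod[of p] dest_mod[of p'] by simp
    have "[p = p'] (mod k ^ u)" using n by (rule cong_modulus_mult_nat)
    then have "p mod (k ^ u * k) = p' mod (k ^ u * k)"
      using top by (simp add: mod_mult2_eq cong_def)
    then have "[p = p'] (mod K)" by (simp add: cong_def mult.commute)
    moreover have "[p = p'] (mod q)" using n by (rule cong_dvd_modulus_nat) simp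
    ultimately show "p = p'" using p by (intro cong_N_I) auto
  qed
  moreover have "dest ` {..<N} \<subseteq> {..<N}" using dest_less by auto
  ultimately show ?thesis by (simp add: bij_betw_def endo_inj_surj)
qed

lemma bij_src: "bij_betw src {..<N} {..<N}"
  unfolding src_def by (rule bij_betw_inv_into[OF bij_dest])

lemma dest_src: "x < N \<Longrightarrow> dest (src x) = x"
  unfolding src_def using bij_betw_inv_into_right[OF bij_dest] by simp

lemma src_less: "x < N \<Longrightarrow> src x < N"
  using bij_betw_apply[OF bij_src] by simp

lemma src_pow_less: "x < N \<Longrightarrow> (src ^^ i) x < N"
  by (induction i) (auto intro: src_less)

lemma src_mod: "x < N \<Longrightarrow> src x mod n = x div k"
  and src_top: "x < N \<Longrightarrow> src x div k ^ u mod k = x mod k"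
  using dest_src[of x] dest_div[of "src x"] dest_mod[of "src x"] by simp_all

text \<open>The source of place \<open>j\<close> in block \<open>l\<close> shares its low digits with \<open>l\<close> and has top digit \<open>j\<close>, whereas
  \<open>k * l + j\<close> has the same digits with \<open>j\<close> moved to the bottom.\<close>

lemma D_src_index:
  assumes "l < n" and "j < k"
  shows "D (src (k * l + j)) = digit_sum k u l + j"
proof -
  have x: "k * l + j < N" using assms by (rule index_less)
  have "[src (k * l + j) = l] (mod n)" using src_mod[OF x] assms by (simp add: cong_def)
  then have "[src (k * l + j) = l] (mod k ^ u)" by (rule cong_modulus_mult_nat)
  then have "digit_sum k u (src (k * l + j)) = digit_sum k u l" by (rule digit_sum_cong[OF pos(1)])
  then show ?thesis using src_top[OF x] assms by (simp add: digit_sum_top)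
qed

lemma D_src: "x < N \<Longrightarrow> D (src x) = D x"
  using D_src_index[of "x div k" "x mod k"] digit_sum_append[of "x mod k" k u "x div k"] pos
  by (simp add: less_mult_imp_div_less mult.commute)

lemma D_src_pow: "x < N \<Longrightarrow> D ((src ^^ i) x) = D x"
  by (induction i) (auto simp: D_src src_pow_less)

text \<open>The linearisation: with \<open>j\<close> the digit that moves from top to bottom, \<open>p\<close> becomes \<open>k p + j\<close>
  modulo \<open>q\<close> and \<open>r = p mod K\<close> becomes \<open>k r - (K - 1) j\<close>. In \<open>(K - 1) p + r\<close> the terms in \<open>j\<close>
  cancel.\<close>

definition Y :: "nat \<Rightarrow> nat" where
  "Y p = (K - 1) * p + p mod K"

lemma Y_dest: "[k * Y p = Y (dest p)] (mod s)"
proof -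
  define l i j where "l = p mod n" and "i = p div n" and "j = p div k ^ u mod k"
  have p: "p = l + i * n" unfolding l_def i_def by (rule mod_div_mult_eq[symmetric])
  have x: "dest p = k * l + j" by (simp add: dest_def l_def j_def)
  have j: "j < k" using pos by (simp add: j_def)
  have "p mod k ^ u = l mod k ^ u" by (simp add: l_def mod_mod_cancel)
  then have r: "p mod K = k ^ u * j + l mod k ^ u"
    using mod_mult2_eq[of p "k ^ u" k] by (simp add: j_def mult.commute)
  have r': "(k * l + j) mod K = k * (l mod k ^ u) + j"
    using mod_mult2_eq[of "k * l + j" k "k ^ u"] j by simp
  obtain m where m: "K = Suc m" using pos by (cases K) auto
  have top: "k * (k ^ u * j) = j + m * j" using m by (simp flip: mult.assoc)
  have rest: "k * (m * p) = m * (k * l) + m * q * (i * (k * k ^ u))"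
    unfolding p by (simp add: algebra_simps)
  have m': "K - 1 = m" using m by simp
  then have "k * Y p = Y (dest p) + s * (i * k ^ Suc u)"
    unfolding Y_def r r' m' x distrib_left top rest by simp
  then show ?thesis by (simp add: cong_def)
qed

lemma Y_src: "x < N \<Longrightarrow> [k * Y (src x) = Y x] (mod s)"
  using Y_dest[of "src x"] dest_src by simp

lemma Y_src_pow: "x < N \<Longrightarrow> [k ^ i * Y ((src ^^ i) x) = Y x] (mod s)"
proof (induction i)
  case (Suc i)
  have "[k ^ i * (k * Y (src ((src ^^ i) x))) = k ^ i * Y ((src ^^ i) x)] (mod s)"
    using Suc.prems by (intro cong_mult cong_refl Y_src src_pow_less)
  with Suc show ?case by (auto simp: ac_simps intro: cong_trans)
qed simp

lemma coprime_k_s: "coprime k s"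
proof -
  have "coprime (K - 1) K" using pos by (intro coprime_diff_one_left_nat) simp
  then have "coprime k (K - 1)" by (simp add: coprime_commute)
  then show ?thesis using coprime_qk by (simp add: coprime_commute)
qed

text \<open>Modulo \<open>K - 1\<close> the invariant gives the residue of \<open>x mod K\<close>, which leaves only the values \<open>0\<close>
  and \<open>K - 1\<close> indistinguishable; the hypothesis on \<open>D\<close> separates these two.\<close>

lemma Y_inj:
  assumes Y: "[Y x = Y x'] (mod s)" and D: "D x = 0 \<longleftrightarrow> D x' = 0"
    and less: "x < N" "x' < N"
  shows "x = x'"
proof -
  have K: "K dvd x \<longleftrightarrow> K dvd x'" using D pos by (simp only: digit_sum_eq_0_iff)
  define r r' where "r = x mod K" and "r' = x' mod K"
  have r: "r < K" "r' < K" "r = 0 \<longleftrightarrow> r' = 0"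
    using pos K by (simp_all add: r_def r'_def dvd_eq_mod_eq_0)
  have "[Y x = Y x'] (mod (K - 1))" using Y by (rule cong_modulus_mult_nat)
  then have cong: "[r = r'] (mod (K - 1))"
    by (simp add: Y_def cong_def r_def r'_def)
  have eq: "r = r'"
  proof (cases "r = 0")
    case False
    have "[Suc (r - 1) = Suc (r' - 1)] (mod (K - 1))" using cong r False by simp
    then have "[r - 1 = r' - 1] (mod (K - 1))"
      by (metis cong_add_rcancel_nat Suc_eq_plus1)
    then have "r - 1 = r' - 1"
      by (rule cong_less_modulus_unique_nat) (use r False in linarith)+
    then show ?thesis using r False by simp
  qed (use r in simp)
  have "[(K - 1) * x = (K - 1) * x'] (mod s)"
    using Y eq unfolding Y_def r_def r'_def by (metis cong_add_rcancel_nat)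
  moreover have "K - 1 \<noteq> 0" using pos by simp
  ultimately have "[x = x'] (mod q)"
    by (simp only: cong_def mod_mult_mult1 mult_cancel1) simp
  moreover have "[x = x'] (mod K)" using eq by (simp add: cong_def r_def r'_def)
  ultimately show ?thesis using less by (rule cong_N_I)
qed

lemma src_pow_ord: "x < N \<Longrightarrow> (src ^^ ord s k) x = x"
proof (rule Y_inj)
  assume x: "x < N"
  have "[1 * Y ((src ^^ ord s k) x) = k ^ ord s k * Y ((src ^^ ord s k) x)] (mod s)"
    by (intro cong_mult cong_refl cong_sym[OF ord])
  with Y_src_pow[OF x] show "[Y ((src ^^ ord s k) x) = Y x] (mod s)"
    by (auto intro: cong_trans)
qed (auto simp: D_src_pow src_pow_less)

section \<open>Shuffling as relabelling\<close>

text \<open>The effect of \<open>dest\<close> on stacks, blind to the labels.\<close>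

definition relabel :: "'a list \<Rightarrow> 'a list" where
  "relabel a = map (\<lambda>x. a ! src x) [0..<N]"

lemma length_relabel [simp]: "length (relabel a) = N"
  by (simp add: relabel_def)

lemma length_shuffle: "length a = N \<Longrightarrow> length (stack_shuffle k a) = N"
  using pos by (simp add: stack_shuffle_def Let_def length_concat_blocks)

lemma length_shuffle_pow: "length a = N \<Longrightarrow> length ((stack_shuffle k ^^ i) a) = N"
  by (induction i) (auto simp: length_shuffle)

text \<open>Listing the cards of a block by their top digit instead of their position does not change the
  multiset that is sorted.\<close>

lemma block_eq_sort_relabel:
  fixes a :: "'a::linorder list"
  assumes l: "l < n"
  shows "block k n a l = rev (sort (map (\<lambda>j. a ! src (k * l + j)) [0..<k]))"
proof -
  define P where "P = {p. p < N \<and> p mod n = l}"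
  have surj: "(\<lambda>i. l + i * n) ` {0..<k} = P"
  proof (intro equalityI subsetI)
    fix p assume "p \<in> (\<lambda>i. l + i * n) ` {0..<k}"
    then obtain i where i: "i < k" "p = l + i * n" by auto
    have "p < Suc i * n" using i l by simp
    also have "\<dots> \<le> N" using i by (intro mult_le_mono1) simp
    finally show "p \<in> P" using i l by (simp add: P_def)
  next
    fix p assume p: "p \<in> P"
    then have "p = l + (p div n) * n" using div_mult_mod_eq[of p n] by (simp add: P_def)
    moreover have "p div n < k" using p by (simp add: P_def less_mult_imp_div_less)
    ultimately show "p \<in> (\<lambda>i. l + i * n) ` {0..<k}" by (metis atLeast0LessThan imageI lessThan_iff)
  qed
  have surj': "(\<lambda>j. src (k * l + j)) ` {0..<k} = P"
  proof (intro equalityI subsetI)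
    fix p assume "p \<in> (\<lambda>j. src (k * l + j)) ` {0..<k}"
    then obtain j where j: "j < k" "p = src (k * l + j)" by auto
    then show "p \<in> P"
      using index_less[OF l] src_less src_mod[of "k * l + j"] by (simp add: P_def)
  next
    fix p assume p: "p \<in> P"
    have "src (dest p) = p" unfolding src_def
      using bij_betw_inv_into_left[OF bij_dest] p by (simp add: P_def)
    moreover have "dest p = k * l + dest p mod k"
      using p dest_div[of p] mult_div_mod_eq[of k "dest p"] by (simp add: P_def)
    moreover have "dest p mod k < k" using pos by simp
    ultimately show "p \<in> (\<lambda>j. src (k * l + j)) ` {0..<k}"
      by (metis atLeast0LessThan imageI lessThan_iff)
  qed
  have inj: "inj_on (\<lambda>i. l + i * n) {0..<k}" using pos q by (auto intro: inj_onI)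
  have inj': "inj_on (\<lambda>j. src (k * l + j)) {0..<k}"
  proof (rule inj_onI)
    fix j j' assume "j \<in> {0..<k}" "j' \<in> {0..<k}" "src (k * l + j) = src (k * l + j')"
    then have "k * l + j = k * l + j'" using dest_src index_less[OF l] by (metis atLeastLessThan_iff)
    then show "j = j'" by simp
  qed
  have "mset (map (\<lambda>i. a ! (l + i * n)) [0..<k]) = image_mset ((!) a) (mset_set P)"
    unfolding surj[symmetric] image_mset_mset_set[OF inj, symmetric]
    by (simp add: multiset.map_comp comp_def)
  moreover have "mset (map (\<lambda>j. a ! src (k * l + j)) [0..<k]) = image_mset ((!) a) (mset_set P)"
    unfolding surj'[symmetric] image_mset_mset_set[OF inj', symmetric]
    by (simp add: multiset.map_comp comp_def)
  ultimately show ?thesis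
    unfolding block_def by (metis properties_for_sort mset_sort sorted_sort)
qed

lemma nth_shuffle:
  assumes "length a = N" and "l < n" and "j < k"
  shows "stack_shuffle k a ! (k * l + j) = rev (sort (map (\<lambda>j. a ! src (k * l + j)) [0..<k])) ! j"
proof -
  have "stack_shuffle k a ! (k * l + j) = block k n a l ! j"
    using assms pos by (simp add: stack_shuffle_def Let_def nth_concat_blocks)
  then show ?thesis using assms by (simp add: block_eq_sort_relabel)
qed

lemma shuffle_eq_relabelI:
  assumes len: "length a = N"
    and sorted: "\<And>l. l < n \<Longrightarrow> rev (sort (map (\<lambda>j. a ! src (k * l + j)) [0..<k]))
      = map (\<lambda>j. a ! src (k * l + j)) [0..<k]"
  shows "stack_shuffle k a = relabel a"
proof (rule nth_equalityI)
  fix x assume "x < length (stack_shuffle k a)"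
  then have x: "x < N" using len by (simp add: length_shuffle)
  then have "x div k < n" "x mod k < k" using pos by (simp_all add: less_mult_imp_div_less mult.commute)
  with nth_shuffle[OF len, of "x div k" "x mod k"] sorted[of "x div k"] x
  show "stack_shuffle k a ! x = relabel a ! x" by (simp add: relabel_def)
qed (simp add: len length_shuffle)

definition weight :: "bool list \<Rightarrow> nat" where
  "weight a = (\<Sum>x<N. of_bool (a ! x) * D x)"

lemma sum_by_blocks: "(\<Sum>x<N. f x) = (\<Sum>l<n. \<Sum>j<k. f (k * l + j))" for f :: "nat \<Rightarrow> nat"
proof -
  have "(\<Sum>x<N. f x) = (\<Sum>l<n. sum f {l * k..<l * k + k})"
    by (simp add: sum.nat_group mult.commute)
  also have "\<dots> = (\<Sum>l<n. \<Sum>j<k. f (k * l + j))"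
  proof (rule sum.cong[OF refl])
    fix l
    show "sum f {l * k..<l * k + k} = (\<Sum>j<k. f (k * l + j))"
      using sum.atLeastLessThan_shift_0[of f "l * k" "l * k + k"]
      by (simp add: mult.commute atLeast0LessThan)
  qed
  finally show ?thesis .
qed

text \<open>As \<open>src\<close> preserves \<open>D\<close>, the weight does not change under \<open>relabel\<close>, and the shuffle differs
  from \<open>relabel\<close> only by sorting each block, where the weights grow along the block.\<close>

lemma weight_shuffle:
  assumes len: "length a = N"
  shows "weight (stack_shuffle k a) \<le> weight a"
    and "weight (stack_shuffle k a) = weight a \<Longrightarrow> stack_shuffle k a = relabel a"
proof -
  define b where "b l = map (\<lambda>j. a ! src (k * l + j)) [0..<k]" for l
  define before where "before l = (\<Sum>j<k. of_bool (b l ! j) * (digit_sum k u l + j))" for l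
  define after where "after l = (\<Sum>j<k. of_bool (rev (sort (b l)) ! j) * (digit_sum k u l + j))" for l
  have "weight a = (\<Sum>x<N. of_bool (a ! src x) * D (src x))"
    unfolding weight_def by (rule sum.reindex_bij_betw[OF bij_src, symmetric])
  also have "\<dots> = (\<Sum>l<n. before l)"
    unfolding sum_by_blocks before_def b_def by (intro sum.cong refl) (simp add: D_src_index)
  finally have W: "weight a = (\<Sum>l<n. before l)" .
  have W': "weight (stack_shuffle k a) = (\<Sum>l<n. after l)"
    unfolding weight_def sum_by_blocks after_def b_def
    by (intro sum.cong refl) (simp add: nth_shuffle[OF len] digit_sum_append)
  have le: "after l \<le> before l" for l
    unfolding before_def after_def by (rule bool_sort_weight) (simp add: b_def)
  show "weight (stack_shuffle k a) \<le> weight a" unfolding W W' by (intro sum_mono le)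
  assume "weight (stack_shuffle k a) = weight a"
  then have "after l = before l" if "l < n" for l
    using sum_mono_inv[of after "{..<n}" before l] le that W W' by auto
  then have "rev (sort (b l)) = b l" if "l < n" for l
    using that unfolding before_def after_def
    by (intro bool_sort_weight(2)[where e = "digit_sum k u l" and k = k]) (auto simp only: b_def length_map length_upt)
  then show "stack_shuffle k a = relabel a"
    by (intro shuffle_eq_relabelI len) (simp add: b_def)
qed

lemma nth_relabel_pow: "x < N \<Longrightarrow> (relabel ^^ i) a ! x = a ! (src ^^ i) x"
proof (induction i arbitrary: x)
  case (Suc i)
  then show ?case by (simp add: relabel_def src_less funpow_swap1)
qed simp

lemma relabel_pow_ord:
  assumes "length a = N"
  shows "(relabel ^^ ord s k) a = a"
proof (rule nth_equalityI)
  show len: "length ((relabel ^^ ord s k) a) = length a"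
    using assms by (cases "ord s k") auto
  show "(relabel ^^ ord s k) a ! x = a ! x" if "x < length ((relabel ^^ ord s k) a)" for x
    using that src_pow_ord[of x] nth_relabel_pow[of x "ord s k" a] by (simp only: len assms)
qed

text \<open>A weakly decreasing sequence that returns to its first value is constant, so along a periodic
  orbit every shuffle is a relabelling.\<close>

lemma bool_shuffle_pow_ord:
  fixes a :: "bool list"
  assumes len: "length a = N" and m: "m > 0" and per: "(stack_shuffle k ^^ m) a = a"
  shows "(stack_shuffle k ^^ ord s k) a = a"
proof -
  define w where "w i = weight ((stack_shuffle k ^^ i) a)" for i
  have dec: "decseq w"
    unfolding w_def by (intro decseq_SucI) (auto intro: weight_shuffle length_shuffle_pow len)
  have w: "w i = w 0" for i
  proof (rule antisym)
    show "w i \<le> w 0" using dec by (rule decseqD) simp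
    have "(stack_shuffle k ^^ (m * i)) a = a"
      using per by (induction i) (simp_all add: funpow_add)
    then have "w (m * i) = w 0" by (simp add: w_def)
    moreover have "w (m * i) \<le> w i" using m by (intro decseqD[OF dec]) simp
    ultimately show "w 0 \<le> w i" by simp
  qed
  have "(stack_shuffle k ^^ i) a = (relabel ^^ i) a" for i
  proof (induction i)
    case (Suc i)
    have "stack_shuffle k ((stack_shuffle k ^^ i) a) = relabel ((stack_shuffle k ^^ i) a)"
      using w[of i] w[of "Suc i"] by (intro weight_shuffle length_shuffle_pow len) (simp add: w_def)
    then show ?case using Suc by simp
  qed simp
  then show ?thesis using relabel_pow_ord[OF len] by (simp only:)
qed

lemma map_shuffle_pow_mono:
  assumes "mono f" and "length a = N"
  shows "map f ((stack_shuffle k ^^ i) a) = (stack_shuffle k ^^ i) (map f a)"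
proof (induction i)
  case (Suc i)
  have "map f (stack_shuffle k ((stack_shuffle k ^^ i) a)) = stack_shuffle k (map f ((stack_shuffle k ^^ i) a))"
    using assms by (intro map_stack_shuffle_mono[where n = n]) (simp_all add: length_shuffle_pow)
  then show ?case using Suc by simp
qed simp

text \<open>The image of a periodic stack under a threshold map is periodic, and the thresholds
  \<open>c \<le> x\<close> for all \<open>c\<close> determine \<open>x\<close>.\<close>

lemma shuffle_pow_ord:
  fixes a :: "'a::linorder list"
  assumes len: "length a = N" and per: "periodic_stack k a"
  shows "(stack_shuffle k ^^ ord s k) a = a"
proof -
  define b where "b = (stack_shuffle k ^^ ord s k) a"
  obtain m where m: "m > 0" "(stack_shuffle k ^^ m) a = a"
    using per by (auto simp: periodic_stack_def)
  have thresholds: "map ((\<le>) c) b = map ((\<le>) c) a" for c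
  proof -
    have mono: "mono ((\<le>) c)" by (auto intro!: monoI)
    have "(stack_shuffle k ^^ m) (map ((\<le>) c) a) = map ((\<le>) c) a"
      using map_shuffle_pow_mono[OF mono len, of m] m by simp
    then show ?thesis
      unfolding b_def map_shuffle_pow_mono[OF mono len]
      using m len by (intro bool_shuffle_pow_ord) auto
  qed
  have lenb: "length b = N" using len by (simp add: b_def length_shuffle_pow)
  have "b ! x = a ! x" if "x < N" for x
  proof -
    have "c \<le> b ! x \<longleftrightarrow> c \<le> a ! x" for c
      using arg_cong[OF thresholds[of c], of "\<lambda>z. z ! x"] that len lenb by simp
    then show ?thesis by (metis order_antisym order_refl)
  qed
  then show ?thesis using len lenb unfolding b_def[symmetric] by (intro nth_equalityI) auto
qed

section \<open>Stacks of prescribed period\<close>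

definition low_stack :: "(nat \<Rightarrow> bool) \<Rightarrow> nat list" where
  "low_stack Q = map (\<lambda>x. of_bool (D x = 0 \<or> D x = 1 \<and> Q x)) [0..<N]"

text \<open>Within a block the digit sums of the sources are \<open>e, e + 1, \<dots>, e + k - 1\<close>. If \<open>e = 0\<close>, the first
  card has label 1 and only the second is subject to \<open>Q\<close>; if \<open>e > 0\<close>, at most the first can have
  label 1. Either way the sorting changes nothing.\<close>

lemma shuffle_low_stack: "stack_shuffle k (low_stack Q) = low_stack (\<lambda>x. Q (src x))"
proof -
  have "stack_shuffle k (low_stack Q) = relabel (low_stack Q)"
  proof (rule shuffle_eq_relabelI)
    fix l assume l: "l < n"
    let ?f = "\<lambda>j. low_stack Q ! src (k * l + j)"
    have f: "?f j = of_bool (digit_sum k u l + j = 0 \<or>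
        digit_sum k u l + j = 1 \<and> Q (src (k * l + j)))" if "j < k" for j
    proof -
      have "src (k * l + j) < N" using that l by (intro src_less index_less)
      then show ?thesis unfolding low_stack_def by (simp only: nth_map_upt diff_zero add_0 D_src_index l that)
    qed
    have "?f j \<le> ?f i" if "i \<le> j" "j < k" for i j
    proof (cases "i = j")
      case False
      then show ?thesis using that f[of i] f[of j] by auto
    qed simp
    then have "sorted (rev (map ?f [0..<k]))"
      by (simp add: sorted_rev_iff_nth_mono)
    then show "rev (sort (map ?f [0..<k])) = map ?f [0..<k]"
      by (intro rev_sort_eqI) simp
  qed (simp add: low_stack_def)
  then show ?thesis
    by (simp add: relabel_def low_stack_def src_less D_src)
qed

lemma shuffle_pow_low_stack:
  "(stack_shuffle k ^^ i) (low_stack Q) = low_stack (\<lambda>x. Q ((src ^^ i) x))"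
proof (induction i)
  case (Suc i)
  then show ?case by (simp add: shuffle_low_stack funpow_swap1)
qed simp

lemma low_stack_eq_iff:
  "low_stack Q = low_stack Q' \<longleftrightarrow> (\<forall>x<N. D x = 1 \<longrightarrow> Q x = Q' x)"
proof -
  have "low_stack Q = low_stack Q' \<longleftrightarrow>
      (\<forall>x<N. (D x = 0 \<or> D x = 1 \<and> Q x) = (D x = 0 \<or> D x = 1 \<and> Q' x))"
    unfolding low_stack_def by (simp only: map_eq_conv of_bool_eq_iff set_upt atLeast0LessThan
        Ball_def lessThan_iff)
  then show ?thesis by auto
qed

text \<open>The position that is \<open>1\<close> modulo \<open>K\<close> and \<open>0\<close> modulo \<open>q\<close>.\<close>

lemma exists_unit: "\<exists>x<N. D x = 1 \<and> [Y x = 1] (mod s)"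
proof -
  obtain x0 where x0: "[x0 = 1] (mod K)" "[x0 = 0] (mod q)"
    using binary_chinese_remainder_nat[OF coprime_K_q] by blast
  define x where "x = x0 mod N"
  have "[x = x0] (mod N)" by (simp add: x_def)
  then have "[x = x0] (mod K)" "[x = x0] (mod q)"
    unfolding N_eq by (auto intro: cong_dvd_modulus_nat)
  then have x: "[x = 1] (mod K)" "[x = 0] (mod q)" using x0 by (auto intro: cong_trans)
  have "D x = D 1" using x(1) by (rule digit_sum_cong[OF pos(1)])
  also have "D 1 = 1" using digit_sum_append[of 1 k u 0] k by (simp add: digit_sum_def)
  finally have "D x = 1" .
  moreover have "x mod K = 1" using x(1) pos(4) by (simp only: cong_def mod_less)
  then have "Y x = (K - 1) * x + 1" by (simp only: Y_def)
  moreover have "[(K - 1) * x + 1 = 0 + 1] (mod s)"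
    using x(2) by (intro cong_add cong_refl) (simp add: cong_0_iff)
  ultimately have "D x = 1 \<and> [Y x = 1] (mod s)" by (simp only: add_0)
  moreover have "x < N" using pos by (simp add: x_def)
  ultimately show ?thesis by blast
qed

definition orbit_stack :: "nat \<Rightarrow> nat list" where
  "orbit_stack d = low_stack (\<lambda>x. \<exists>j. [Y x = k ^ (d * j)] (mod s))"

text \<open>After \<open>i\<close> shuffles the chosen positions are those whose invariant lies in the coset
  \<open>k\<^sup>i \<langle>k\<^sup>d\<rangle>\<close> of the group generated by \<open>k\<close> modulo \<open>s\<close>. As \<open>d\<close> divides the order of that
  group, the coset is the subgroup itself exactly if \<open>d\<close> divides \<open>i\<close>; the position with invariant 1
  detects this.\<close>

lemma orbit_stack_period:
  assumes d: "d dvd ord s k"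
  shows "(stack_shuffle k ^^ i) (orbit_stack d) = orbit_stack d \<longleftrightarrow> d dvd i"
proof -
  let ?Q = "\<lambda>i x. \<exists>j. [Y x = k ^ (i + d * j)] (mod s)"
  obtain f where f: "ord s k = d * f" using d by auto
  have shift: "[Y ((src ^^ i) x) = k ^ m] (mod s) \<longleftrightarrow> [Y x = k ^ (i + m)] (mod s)"
    if "x < N" for x m
  proof -
    have "[Y ((src ^^ i) x) = k ^ m] (mod s) \<longleftrightarrow> [k ^ i * Y ((src ^^ i) x) = k ^ i * k ^ m] (mod s)"
      using coprime_k_s by (intro cong_mult_lcancel_nat[symmetric]) simp
    also have "\<dots> \<longleftrightarrow> [Y x = k ^ (i + m)] (mod s)"
      using Y_src_pow[OF that, of i] by (auto simp: power_add intro: cong_trans cong_sym)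
    finally show ?thesis .
  qed
  have iff: "(stack_shuffle k ^^ i) (orbit_stack d) = orbit_stack d \<longleftrightarrow>
      (\<forall>x<N. D x = 1 \<longrightarrow> ?Q i x = ?Q 0 x)"
    unfolding orbit_stack_def shuffle_pow_low_stack low_stack_eq_iff
    by (intro all_cong imp_cong refl) (simp only: shift add_0)
  show ?thesis
  proof
    assume eq: "(stack_shuffle k ^^ i) (orbit_stack d) = orbit_stack d"
    obtain x where x: "x < N" "D x = 1" "[Y x = 1] (mod s)" using exists_unit by blast
    then have "?Q 0 x" by (intro exI[of _ 0]) simp
    then have "?Q i x" using eq iff x by blast
    then obtain j where "[Y x = k ^ (i + d * j)] (mod s)" by blast
    then have "[k ^ (i + d * j) = 1] (mod s)" using x(3) by (metis cong_sym cong_trans)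
    then have "d dvd i + d * j" using d unfolding ord_divides by (metis dvd_trans)
    then show "d dvd i" by (metis dvd_add_left_iff dvd_triv_left)
  next
    assume "d dvd i"
    then obtain e where e: "i = d * e" by auto
    have "?Q i x = ?Q 0 x" for x
    proof
      assume "?Q i x"
      then obtain j where "[Y x = k ^ (0 + d * (e + j))] (mod s)"
        by (auto simp: e distrib_left)
      then show "?Q 0 x" by blast
    next
      assume "?Q 0 x"
      then obtain j where j: "[Y x = k ^ (d * j)] (mod s)" by auto
      \<comment> \<open>Adding the multiple \<open>e * ord s k\<close> to the exponent keeps the difference \<open>j - e\<close> non-negative.\<close>
      define j' where "j' = j + e * f - e"
      have "ord s k \<noteq> 0" using coprime_k_s unfolding ord_eq_0 by (simp only: coprime_commute not_not)
      then have "f > 0" using f by (metis gr0I mult_0_right)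
      then have "e + j' = j + e * f" by (cases f) (auto simp: j'_def)
      then have "i + d * j' = d * j + ord s k * e"
        unfolding e f by (metis distrib_left mult.assoc mult.commute)
      moreover have "[k ^ (d * j + ord s k * e) = k ^ (d * j) * 1] (mod s)"
        unfolding power_add by (intro cong_mult cong_refl) (simp only: ord_divides dvd_triv_left)
      ultimately have "[Y x = k ^ (i + d * j')] (mod s)"
        using j by (metis cong_sym cong_trans mult.right_neutral)
      then show "?Q i x" by blast
    qed
    then show "(stack_shuffle k ^^ i) (orbit_stack d) = orbit_stack d" using iff by blast
  qed
qed

end

lemma stack_period_dvd:
  assumes per: "periodic_stack k a" and M: "(stack_shuffle k ^^ M) a = a"
  shows "stack_period k a dvd M"
proof -
  let ?F = "stack_shuffle k"
  define p where "p = stack_period k a"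
  have p: "p > 0 \<and> (?F ^^ p) a = a"
    unfolding p_def stack_period_def by (rule LeastI_ex) (use per in \<open>auto simp: periodic_stack_def\<close>)
  have "(?F ^^ (M mod p)) a = a"
    using p M by (metis funpow_mod_eq)
  moreover have "p \<le> m" if "m > 0" "(?F ^^ m) a = a" for m
    unfolding p_def stack_period_def using that by (intro Least_le) simp
  moreover have "M mod p < p" using p by simp
  ultimately have "M mod p = 0" by (metis gr0I leD)
  then show ?thesis by (auto simp: p_def)
qed

theorem mainTheorem2:
  fixes k t q N :: nat
  assumes "k \<ge> 2" and "t \<ge> 1" and "q \<ge> 1" and "coprime q k" and "N = k ^ t * q"
  shows "(\<forall>(A :: 'a::linorder set) a. finite A \<longrightarrow> is_stack A N a \<longrightarrow> periodic_stack k a \<longrightarrow>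
            stack_period k a dvd ord (N - q) k)
       \<and> (\<forall>d. d > 0 \<longrightarrow> d dvd ord (N - q) k \<longrightarrow>
            (\<exists>(A :: nat set) a. finite A \<and> is_stack A N a \<and> periodic_stack k a \<and>
               stack_period k a = d))"
proof -
  obtain u where t: "t = Suc u" using assms(2) by (cases t) auto
  interpret stack_params k u q using assms by unfold_locales
  have N: "N = k * (k ^ u * q)" using assms(5) t by simp
  have s: "N - q = (k ^ Suc u - 1) * q" using assms(5) t by (simp add: diff_mult_distrib)
  show ?thesis
    unfolding s
  proof (intro conjI allI impI)
    fix A :: "'a set" and a
    assume "is_stack A N a" and per: "periodic_stack k a"
    then have "length a = k * (k ^ u * q)" using N by (simp add: is_stack_def)
    then show "stack_period k a dvd ord ((k ^ Suc u - 1) * q) k"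
      using per by (intro stack_period_dvd shuffle_pow_ord)
  next
    fix d :: nat
    assume d: "d > 0" "d dvd ord ((k ^ Suc u - 1) * q) k"
    note iff = orbit_stack_period[OF d(2)]
    have "is_stack {0, 1} N (orbit_stack d)"
      by (auto simp: is_stack_def orbit_stack_def low_stack_def N)
    moreover have "periodic_stack k (orbit_stack d)"
      unfolding periodic_stack_def iff using d(1) by (intro exI[of _ d]) simp
    moreover have "stack_period k (orbit_stack d) = d"
      unfolding stack_period_def iff using d(1) by (intro Least_equality) (simp_all add: dvd_imp_le)
    ultimately show "\<exists>(A :: nat set) a. finite A \<and> is_stack A N a \<and> periodic_stack k a \<and> stack_period k a = d"
      by (metis finite.emptyI finite.insertI)
  qed
qed

end
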